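(* Let $B$ be a finite clean, path-reachable bidirected graph rooted at $r$, and let $D=D_B^{\mathrm{path}}$ be its skeleton. Then (1) $\kappa_B(r,x)=\kappa_D(r,x)$ for all $x\in V(D)\setminus\{r\}$; and (2) $\kappa_B(r,x)=1$ for all $x\in V(B)\setminus V(D)$.
   Context: A bidirected graph $B=(G,\sigma)$ is a loopless multigraph $G$ together with a map $\sigma$ assigning to each half-edge $(e,u)$ ($u$ an endpoint of the edge $e$) a sign $\sigma(e,u)\in\{+,-\}$. An oriented edge $\vec e$ is an edge $e$ with a choice of which endpoint is its tail and which its head; $\overleftarrow{e}$ is the opposite orientation. A trail is a sequence $v_0\vec e_1v_1\dots\vec e_\ell v_\ell$ in which the edges $e_i$ are pairwise distinct, $\vec e_i$ has tail $v_{i-1}$ and head $v_i$, and $\sigma(e_{i+1},v_i)=-\sigma(e_i,v_i)$ for $1\le i<\ell$; it is a $v_0$--$v_\ell$ trail, trivial if $\ell=0$. A path is a trail that does not repeat vertices. A $v$--$(w,\alpha)$ path is a path from $v$ to $w$ whose last edge has sign $\alpha$ at $w$. An almost path is a trail that is trivial or becomes a path on removing its last edge (and last vertex). $B$ is rooted if it has a designated root vertex $r$; it is clean if there is no nontrivial $r$--$r$ almost path. An $r$--$\vec e$ path (almost path) is a path (almost path) starting in $r$ whose last oriented edge is $\vec e$. $B$ is path-reachable if every edge $e$ has an orientation $\vec e$ admitting an $r$--$\vec e$ path. A vertex $v\neq r$ is plain if for some $\alpha\in\{+,-\}$ there is no $r$--$(v,\alpha)$ path in $B$; $\Pi_B$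 is the set of plain vertices. An edge $e$ is undirectable if $B$ contains both an $r$--$\vec e$ almost path and an $r$--$\overleftarrow{e}$ almost path; it is directable if there is a unique orientation $\vec e$ of $e$ such that $B$ contains an $r$--$\vec e$ almost path, and this $\vec e$ is its natural orientation. The undirectable components $C_1,\dots,C_k$ are the connected components (with at least one edge) of the subgraph formed by the undirectable edges. Each $C_i$ contains exactly one vertex of $\Pi_B\cup\{r\}$, denoted $c_i$. Put $\pi(w)=c_i$ if $w\in V(C_i)$ and $\pi(w)=w$ if $w$ lies in no $C_i$. The skeleton $D_B^{\mathrm{path}}$ is the directed multigraph rooted at $r$ with vertex set $\pi(V(B))$, having for each directable edge $e$ of $B$ with natural orientation from $u$ to $v$ one directed edge from $\pi(u)$ to $\pi(v)$. $\kappa_B(v,w)$ is the maximum number of pairwise internally vertex-disjoint (distinct) $v$--$w$ paths in $B$, and $\kappa_D(v,w)$ is the analogous number for directed paths in a directed multigraph $D$ (parallel edges give distinct paths). *)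

theory Defs
  imports "Graph_Theory.Arc_Walk"
begin

section \<open>Bidirected graphs\<close>

datatype sign = Plus | Minus

primrec opp :: "sign \<Rightarrow> sign" where
  "opp Plus = Minus"
| "opp Minus = Plus"

text \<open>
  Multigraphs may have parallel edges, so edges are abstract objects with a two-element set of ends.
  Without loops a half-edge is just a pair of an edge and one of its ends;
  the values of \<open>ends\<close> and \<open>esign\<close> elsewhere are irrelevant.
\<close>

record ('v, 'e) bigraph =
  bverts :: "'v set"
  bedges :: "'e set"
  ends :: "'e \<Rightarrow> 'v set"
  esign :: "'e \<Rightarrow> 'v \<Rightarrow> sign"

locale bidirected_graph =
  fixes B :: "('v, 'e) bigraph"
  assumes ends_in_verts: "e \<in> bedges B \<Longrightarrow> ends B e \<subseteq> bverts B"
    and two_ends: "e \<in> bedges B \<Longrightarrow> card (ends B e) = 2"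

locale rooted_bidirected_graph = bidirected_graph B for B :: "('v, 'e) bigraph" +
  fixes r :: 'v
  assumes root_in_verts: "r \<in> bverts B"

locale finite_rooted_bidirected_graph = rooted_bidirected_graph +
  assumes finite_bverts: "finite (bverts B)"
    and finite_bedges: "finite (bedges B)"

section \<open>Oriented edges, trails, paths\<close>

text \<open>An oriented edge is a triple of tail, edge and head.\<close>

type_synonym ('v, 'e) oedge = "'v \<times> 'e \<times> 'v"

abbreviation otail :: "('v, 'e) oedge \<Rightarrow> 'v" where "otail a \<equiv> fst a"
abbreviation oedge :: "('v, 'e) oedge \<Rightarrow> 'e" where "oedge a \<equiv> fst (snd a)"
abbreviation ohead :: "('v, 'e) oedge \<Rightarrow> 'v" where "ohead a \<equiv> snd (snd a)"

definition orientations :: "('v, 'e) bigraph \<Rightarrow> 'e \<Rightarrow> ('v, 'e) oedge set" where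
  "orientations B e = {(u, e, v) | u v. ends B e = {u, v}}"

definition reverse :: "('v, 'e) oedge \<Rightarrow> ('v, 'e) oedge" where
  "reverse a = (ohead a, oedge a, otail a)"

definition trail_verts :: "'v \<Rightarrow> ('v, 'e) oedge list \<Rightarrow> 'v list" where
  "trail_verts v p = v # map ohead p"

text \<open>
  The trail \<open>v\<^sub>0 e\<^sub>1 v\<^sub>1 \<dots> e\<^sub>l v\<^sub>l\<close> is given by its start vertex and its list \<open>p\<close> of oriented edges;
  \<open>p ! i\<close> is the edge with number \<open>i + 1\<close>, and \<open>trail_verts v p ! i\<close> is the vertex with number \<open>i\<close>.
\<close>

definition bitrail :: "('v, 'e) bigraph \<Rightarrow> 'v \<Rightarrow> ('v, 'e) oedge list \<Rightarrow> 'v \<Rightarrow> bool" where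
  "bitrail B v p w \<longleftrightarrow>
     v \<in> bverts B \<and>
     (\<forall>a \<in> set p. oedge a \<in> bedges B \<and> a \<in> orientations B (oedge a)) \<and>
     (\<forall>i < length p. otail (p ! i) = trail_verts v p ! i) \<and>
     (\<forall>i. Suc i < length p \<longrightarrow>
        esign B (oedge (p ! Suc i)) (ohead (p ! i)) = opp (esign B (oedge (p ! i)) (ohead (p ! i)))) \<and>
     distinct (map oedge p) \<and>
     last (trail_verts v p) = w"

definition bipath :: "('v, 'e) bigraph \<Rightarrow> 'v \<Rightarrow> ('v, 'e) oedge list \<Rightarrow> 'v \<Rightarrow> bool" where
  "bipath B v p w \<longleftrightarrow> bitrail B v p w \<and> distinct (trail_verts v p)"

definition almost_path :: "('v, 'e) bigraph \<Rightarrow> 'v \<Rightarrow> ('v, 'e) oedge list \<Rightarrow> 'v \<Rightarrow> bool" where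
  "almost_path B v p w \<longleftrightarrow>
     bitrail B v p w \<and> (p = [] \<or> (\<exists>w'. bipath B v (butlast p) w'))"

definition has_signed_path :: "('v, 'e) bigraph \<Rightarrow> 'v \<Rightarrow> 'v \<Rightarrow> sign \<Rightarrow> bool" where
  "has_signed_path B v w \<alpha> \<longleftrightarrow>
     (\<exists>p. bipath B v p w \<and> p \<noteq> [] \<and> esign B (oedge (last p)) w = \<alpha>)"

definition has_path_via :: "('v, 'e) bigraph \<Rightarrow> 'v \<Rightarrow> ('v, 'e) oedge \<Rightarrow> bool" where
  "has_path_via B r a \<longleftrightarrow> (\<exists>p. bipath B r p (ohead a) \<and> p \<noteq> [] \<and> last p = a)"

definition has_almost_path_via :: "('v, 'e) bigraph \<Rightarrow> 'v \<Rightarrow> ('v, 'e) oedge \<Rightarrow> bool" where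
  "has_almost_path_via B r a \<longleftrightarrow> (\<exists>p. almost_path B r p (ohead a) \<and> p \<noteq> [] \<and> last p = a)"

definition clean :: "('v, 'e) bigraph \<Rightarrow> 'v \<Rightarrow> bool" where
  "clean B r \<longleftrightarrow> (\<nexists>p. p \<noteq> [] \<and> almost_path B r p r)"

definition path_reachable :: "('v, 'e) bigraph \<Rightarrow> 'v \<Rightarrow> bool" where
  "path_reachable B r \<longleftrightarrow> (\<forall>e \<in> bedges B. \<exists>a \<in> orientations B e. has_path_via B r a)"

section \<open>The skeleton\<close>

definition plain_verts :: "('v, 'e) bigraph \<Rightarrow> 'v \<Rightarrow> 'v set" where
  "plain_verts B r = {v \<in> bverts B. v \<noteq> r \<and> (\<exists>\<alpha>. \<not> has_signed_path B r v \<alpha>)}"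

definition undirectable :: "('v, 'e) bigraph \<Rightarrow> 'v \<Rightarrow> 'e \<Rightarrow> bool" where
  "undirectable B r e \<longleftrightarrow>
     (\<exists>a \<in> orientations B e. has_almost_path_via B r a \<and> has_almost_path_via B r (reverse a))"

definition directable :: "('v, 'e) bigraph \<Rightarrow> 'v \<Rightarrow> 'e \<Rightarrow> bool" where
  "directable B r e \<longleftrightarrow> (\<exists>!a. a \<in> orientations B e \<and> has_almost_path_via B r a)"

definition natural_orientation :: "('v, 'e) bigraph \<Rightarrow> 'v \<Rightarrow> 'e \<Rightarrow> ('v, 'e) oedge" where
  "natural_orientation B r e = (THE a. a \<in> orientations B e \<and> has_almost_path_via B r a)"

definition undirectable_edges :: "('v, 'e) bigraph \<Rightarrow> 'v \<Rightarrow> 'e set" where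
  "undirectable_edges B r = {e \<in> bedges B. undirectable B r e}"

definition undirectable_adj :: "('v, 'e) bigraph \<Rightarrow> 'v \<Rightarrow> ('v \<times> 'v) set" where
  "undirectable_adj B r = {(u, v). \<exists>e \<in> undirectable_edges B r. ends B e = {u, v}}"

text \<open>
  The vertex sets of the undirectable components. Only vertices covered by undirectable edges are
  considered, so every component has an edge.
\<close>

definition undirectable_components :: "('v, 'e) bigraph \<Rightarrow> 'v \<Rightarrow> 'v set set" where
  "undirectable_components B r =
     (\<Union>e \<in> undirectable_edges B r. ends B e) // (undirectable_adj B r)\<^sup>*"

text \<open>
  In a finite clean path-reachable bidirected graph, every undirectable component \<open>C\<close> contains exactly
  one element of \<open>plain_verts B r \<union> {r}\<close>; only there is this description meaningful.
\<close>

definition component_root :: "('v, 'e) bigraph \<Rightarrow> 'v \<Rightarrow> 'v set \<Rightarrow> 'v" where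
  "component_root B r C = (THE c. c \<in> C \<and> c \<in> plain_verts B r \<union> {r})"

definition skeleton_proj :: "('v, 'e) bigraph \<Rightarrow> 'v \<Rightarrow> 'v \<Rightarrow> 'v" where
  "skeleton_proj B r w =
     (if \<exists>C \<in> undirectable_components B r. w \<in> C
      then component_root B r (THE C. C \<in> undirectable_components B r \<and> w \<in> C)
      else w)"

definition skeleton :: "('v, 'e) bigraph \<Rightarrow> 'v \<Rightarrow> ('v, 'e) pre_digraph" where
  "skeleton B r =
     \<lparr>verts = skeleton_proj B r ` bverts B,
      arcs = {e \<in> bedges B. directable B r e},
      tail = (\<lambda>e. skeleton_proj B r (otail (natural_orientation B r e))),
      head = (\<lambda>e. skeleton_proj B r (ohead (natural_orientation B r e)))\<rparr>"

section \<open>Local connectivity\<close>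

text \<open>
  A path from \<open>v\<close> is determined by its list of (oriented) edges. For \<open>v \<noteq> w\<close>, the internal vertices
  of a path from \<open>v\<close> to \<open>w\<close> are its vertices other than \<open>v\<close> and \<open>w\<close>.
\<close>

definition bi_kappa :: "('v, 'e) bigraph \<Rightarrow> 'v \<Rightarrow> 'v \<Rightarrow> nat" where
  "bi_kappa B v w =
     Max {card P | P. finite P \<and> (\<forall>p \<in> P. bipath B v p w) \<and>
       pairwise (\<lambda>p q. disjnt (set (trail_verts v p) - {v, w}) (set (trail_verts v q) - {v, w})) P}"

definition di_kappa :: "('v, 'e) pre_digraph \<Rightarrow> 'v \<Rightarrow> 'v \<Rightarrow> nat" where
  "di_kappa D v w =
     Max {card P | P. finite P \<and> (\<forall>p \<in> P. pre_digraph.apath D v p w) \<and>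
       pairwise (\<lambda>p q. disjnt (set (pre_digraph.awalk_verts D v p) - {v, w})
         (set (pre_digraph.awalk_verts D v q) - {v, w})) P}"

end

theory Submission
  imports Defs
begin

text \<open>
  The heart of the matter is that two plain vertices never lie in the same undirectable component.
  This is proved for paths avoiding a vertex set \<open>A\<close>, by induction on the number of vertices outside \<open>A\<close>:
  if \<open>c\<close> is plain with respect to \<open>A\<close>, the statement for \<open>A \<union> {c}\<close> shows that every path from \<open>r\<close> to
  a vertex in the component of \<open>c\<close> passes through \<open>c\<close>. For two plain vertices this would hold in both
  directions, which is absurd.

  Consequently a path from \<open>r\<close> enters an undirectable component only along a directable edge into the
  plain vertex of the component, and only once. Forgetting the undirectable edges of a path therefore yields
  a path of the skeleton. Conversely, a path of the skeleton is lifted by inserting, inside each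
  component, the last part of a path from \<open>r\<close> to the tail of the next edge. Both
  translations are injective on the families in question and preserve internal disjointness.
\<close>

section \<open>Trails\<close>

lemma opp_opp [simp]: "opp (opp s) = s"
  by (cases s) auto

lemma opp_neq [simp]: "opp s \<noteq> s" "s \<noteq> opp s"
  by (cases s; simp)+

lemma sign_cases: "P t \<Longrightarrow> P (opp t) \<Longrightarrow> P s"
  by (cases s; cases t) auto

lemma trail_verts_Nil [simp]: "trail_verts v [] = [v]"
  by (simp add: trail_verts_def)

lemma trail_verts_append [simp]: "trail_verts v (p @ q) = trail_verts v p @ map ohead q"
  by (simp add: trail_verts_def)

lemma start_in_trail_verts [simp]: "v \<in> set (trail_verts v p)"
  by (simp add: trail_verts_def)

lemma length_trail_verts [simp]: "length (trail_verts v p) = Suc (length p)"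
  by (simp add: trail_verts_def)

lemma trail_verts_neq_Nil [simp]: "trail_verts v p \<noteq> []"
  by (simp add: trail_verts_def)

lemma trail_verts_nth_length: "trail_verts v p ! length p = last (trail_verts v p)"
  by (simp add: last_conv_nth)

definition arc :: "('v, 'e) bigraph \<Rightarrow> ('v, 'e) oedge \<Rightarrow> bool" where
  "arc B a \<longleftrightarrow> oedge a \<in> bedges B \<and> ends B (oedge a) = {otail a, ohead a}"

abbreviation tsign :: "('v, 'e) bigraph \<Rightarrow> ('v, 'e) oedge \<Rightarrow> sign" where
  "tsign B a \<equiv> esign B (oedge a) (otail a)"

abbreviation hsign :: "('v, 'e) bigraph \<Rightarrow> ('v, 'e) oedge \<Rightarrow> sign" where
  "hsign B a \<equiv> esign B (oedge a) (ohead a)"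

lemma orientations_iff:
  "a \<in> orientations B e \<longleftrightarrow> oedge a = e \<and> ends B e = {otail a, ohead a}"
  by (cases a) (auto simp: orientations_def)

lemma orientations_cases:
  assumes "a \<in> orientations B e" "b \<in> orientations B e"
  shows "b = a \<or> b = reverse a"
  using assms by (cases a; cases b) (auto simp: orientations_def reverse_def doubleton_eq_iff)

lemma reverse_simps [simp]:
  "otail (reverse a) = ohead a" "ohead (reverse a) = otail a" "oedge (reverse a) = oedge a"
  "reverse (reverse a) = a"
  by (simp_all add: reverse_def)

lemma arc_reverse [simp]: "arc B (reverse a) \<longleftrightarrow> arc B a"
  by (auto simp: arc_def insert_commute)

lemma bitrail_Nil [simp]: "bitrail B v [] w \<longleftrightarrow> v \<in> bverts B \<and> w = v"
  by (auto simp: bitrail_def)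

text \<open>This turns the indexed definition into a recursion on the last edge, on which the later
  inductions on paths rest.\<close>

lemma bitrail_snoc:
  "bitrail B v (p @ [a]) w \<longleftrightarrow>
     bitrail B v p (otail a) \<and> arc B a \<and> ohead a = w \<and> oedge a \<notin> oedge ` set p \<and>
     (p \<noteq> [] \<longrightarrow> tsign B a = opp (esign B (oedge (last p)) (otail a)))"
proof -
  have tails: "(\<forall>i < length (p @ [a]). otail ((p @ [a]) ! i) = trail_verts v (p @ [a]) ! i) \<longleftrightarrow>
      (\<forall>i < length p. otail (p ! i) = trail_verts v p ! i) \<and> otail a = last (trail_verts v p)"
    by (auto simp: nth_append less_Suc_eq trail_verts_nth_length)
  have signs: "(\<forall>i. Suc i < length (p @ [a]) \<longrightarrow>
        esign B (oedge ((p @ [a]) ! Suc i)) (ohead ((p @ [a]) ! i)) =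
          opp (esign B (oedge ((p @ [a]) ! i)) (ohead ((p @ [a]) ! i)))) \<longleftrightarrow>
      (\<forall>i. Suc i < length p \<longrightarrow>
        esign B (oedge (p ! Suc i)) (ohead (p ! i)) = opp (esign B (oedge (p ! i)) (ohead (p ! i)))) \<and>
      (p \<noteq> [] \<longrightarrow> esign B (oedge a) (ohead (last p)) = opp (hsign B (last p)))"
    (is "(\<forall>i. ?L i) \<longleftrightarrow> (\<forall>i. ?R i) \<and> ?S")
  proof (cases "length p")
    case (Suc k)
    \<comment> \<open>The sign conditions with and without \<open>a\<close> agree at every index
      except \<open>k\<close>, where \<open>p\<close> ends: there the new condition concerns
      \<open>a\<close> and the old one is vacuous.\<close>
    have split: "(\<forall>i. L i) \<longleftrightarrow> (\<forall>i. R i) \<and> S"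
      if "\<And>i. i \<noteq> k \<Longrightarrow> L i \<longleftrightarrow> R i" "L k \<longleftrightarrow> S" "R k" for L R :: "nat \<Rightarrow> bool" and S
      using that by metis
    have "?L i \<longleftrightarrow> ?R i" if "i \<noteq> k" for i
      using that Suc by (auto simp: nth_append less_Suc_eq)
    moreover have "?L k \<longleftrightarrow> ?S"
    proof -
      have "p \<noteq> []"
        using Suc by auto
      then have "last p = p ! k"
        using Suc by (simp add: last_conv_nth)
      then show ?thesis
        using Suc \<open>p \<noteq> []\<close> by (simp add: nth_append)
    qed
    moreover have "?R k"
      using Suc by simp
    ultimately show ?thesis
      by (rule split)
  qed simp
  have last: "ohead (last p) = last (trail_verts v p)" if "p \<noteq> []"
    using that by (simp add: trail_verts_def last_map)
  have set: "(\<forall>b \<in> set (p @ [a]). P b) \<longleftrightarrow> (\<forall>b \<in> set p. P b) \<and> P a" for P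
    by auto
  have distinct: "distinct (map oedge (p @ [a])) \<longleftrightarrow> distinct (map oedge p) \<and> oedge a \<notin> oedge ` set p"
    by auto
  have ends: "last (trail_verts v (p @ [a])) = ohead a"
    by simp
  have arc: "oedge a \<in> bedges B \<and> a \<in> orientations B (oedge a) \<longleftrightarrow> arc B a"
    by (auto simp: arc_def orientations_iff)
  show ?thesis
    unfolding bitrail_def tails signs set distinct ends arc
    using last by auto
qed

lemma bitrail_imp:
  assumes "bitrail B v p w"
  shows "last (trail_verts v p) = w" "\<And>a. a \<in> set p \<Longrightarrow> arc B a"
  using assms by (auto simp: bitrail_def arc_def orientations_iff)

lemma otail_in_trail_verts:
  assumes "bitrail B v p w" "a \<in> set p"
  shows "otail a \<in> set (butlast (trail_verts v p))"
  using assms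
proof (induction p arbitrary: w rule: rev_induct)
  case (snoc b p)
  then have "bitrail B v p (otail b)"
    by (simp add: bitrail_snoc)
  moreover from this have "otail b \<in> set (trail_verts v p)"
    by (metis bitrail_imp(1) last_in_set trail_verts_neq_Nil)
  ultimately show ?case
    using snoc by (auto simp: butlast_append dest: in_set_butlastD bitrail_imp(1))
qed simp

text \<open>A path meets its end only once, so an earlier edge at that end must be the last one; but
  the signs of \<open>a\<close> and of the last edge differ there. Hence continuing a path never
  repeats an edge, even if it repeats a vertex.\<close>

lemma bipath_new_edge:
  assumes p: "bipath B v p (otail a)"
    and sgn: "p \<noteq> [] \<longrightarrow> tsign B a = opp (esign B (oedge (last p)) (otail a))"
    and a: "arc B a"
  shows "oedge a \<notin> oedge ` set p"
proof
  assume "oedge a \<in> oedge ` set p"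
  then obtain b where b: "b \<in> set p" "oedge b = oedge a"
    by auto
  have tr: "bitrail B v p (otail a)" and dist: "distinct (trail_verts v p)"
    using p by (auto simp: bipath_def)
  have "arc B b"
    using bitrail_imp(2)[OF tr b(1)] .
  then have "otail a = otail b \<or> otail a = ohead b"
    using a b by (auto simp: arc_def)
  moreover have "otail a \<noteq> otail b"
  proof
    assume "otail a = otail b"
    then have "last (trail_verts v p) \<in> set (butlast (trail_verts v p))"
      using otail_in_trail_verts[OF tr b(1)] bitrail_imp(1)[OF tr] by simp
    then show False
      using dist by (metis append_butlast_last_id distinct_append disjoint_iff last_in_set
          list.set_intros(1) trail_verts_neq_Nil)
  qed
  moreover have "otail a \<noteq> ohead b"
  proof
    assume eq: "otail a = ohead b"
    have "ohead (last p) = otail a"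
      using b(1) bitrail_imp(1)[OF tr] by (auto simp: trail_verts_def last_map split: if_splits)
    then have "ohead b = ohead (last p)" "last p \<in> set p"
      using eq b(1) last_in_set[of p] by fastforce+
    then have "b = last p"
      using dist b(1) by (auto simp: trail_verts_def distinct_map dest: inj_onD)
    then show False
      using sgn b by auto
  qed
  ultimately show False
    by blast
qed

section \<open>Directed paths extended by one arc\<close>

lemma (in wf_digraph) apath_snoc_iff:
  "apath u (p @ [e]) v \<longleftrightarrow>
     apath u p (tail G e) \<and> e \<in> arcs G \<and> head G e = v \<and> head G e \<notin> set (awalk_verts u p)"
  (is "?L \<longleftrightarrow> ?R")
proof
  assume ?L
  then show ?R
    unfolding apath_append_iff apath_Cons_iff apath_Nil_iff by auto
next
  assume ?R
  then have "awlast u p = tail G e"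
    by (simp add: apath_def)
  moreover have "tail G e \<in> set (awalk_verts u p)"
    by (metis awalk_verts_non_Nil calculation last_in_set)
  ultimately show ?L
    using \<open>?R\<close> unfolding apath_append_iff apath_Cons_iff apath_Nil_iff by auto
qed

lemma (in wf_digraph) awalk_verts_snoc:
  assumes "apath u (p @ [e]) v"
  shows "awalk_verts u (p @ [e]) = awalk_verts u p @ [head G e]"
  using awalk_verts_append[of u p "[e]" v] assms by (simp add: apath_def)

section \<open>Plain vertices and undirectable edges relative to a forbidden set\<close>

locale clean_bidirected_graph = finite_rooted_bidirected_graph B r
  for B :: "('v, 'e) bigraph" and r +
  assumes clean: "clean B r"
begin

text \<open>\<open>s\<close> is the sign with which the path may be continued at \<open>v\<close>; every sign is possible at the root.\<close>

definition rpath :: "'v set \<Rightarrow> ('v, 'e) oedge list \<Rightarrow> 'v \<Rightarrow> sign \<Rightarrow> bool" where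
  "rpath A p v s \<longleftrightarrow>
     bipath B r p v \<and> set (trail_verts r p) \<inter> A = {} \<and>
     (p = [] \<or> esign B (oedge (last p)) v = opp s)"

definition reach :: "'v set \<Rightarrow> 'v \<Rightarrow> sign \<Rightarrow> bool" where
  "reach A v s \<longleftrightarrow> (\<exists>p. rpath A p v s)"

text \<open>A vertex which is unreachable, or lies in \<open>A\<close>, counts as plain.\<close>

definition plain :: "'v set \<Rightarrow> 'v \<Rightarrow> bool" where
  "plain A v \<longleftrightarrow> v \<noteq> r \<and> (\<exists>s. \<not> reach A v s)"

text \<open>The two ends may be reached by different paths. For empty \<open>A\<close> this is
  adjacency by an undirectable edge, see \<open>undirectable_adj_iff\<close>.\<close>

definition undir :: "'v set \<Rightarrow> 'v \<Rightarrow> 'v \<Rightarrow> bool" where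
  "undir A u v \<longleftrightarrow>
     (\<exists>a. arc B a \<and> otail a = u \<and> ohead a = v \<and> reach A u (tsign B a) \<and> reach A v (hsign B a))"

lemma arc_ends_neq: "arc B a \<Longrightarrow> otail a \<noteq> ohead a"
  using two_ends by (fastforce simp: arc_def)

lemma arc_in_verts: "arc B a \<Longrightarrow> otail a \<in> bverts B \<and> ohead a \<in> bverts B"
  using ends_in_verts by (fastforce simp: arc_def)

lemma rpath_Nil [simp]: "rpath A [] v s \<longleftrightarrow> v = r \<and> r \<notin> A"
  using root_in_verts by (auto simp: rpath_def bipath_def)

text \<open>Distinctness of edges is automatic by \<open>bipath_new_edge\<close>, so only the new
  vertex and the signs have to be checked.\<close>

lemma rpath_snoc:
  "rpath A (p @ [a]) v s \<longleftrightarrow>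
     rpath A p (otail a) (tsign B a) \<and> arc B a \<and> ohead a = v \<and>
     v \<notin> set (trail_verts r p) \<and> v \<notin> A \<and> hsign B a = opp s"
  (is "?L \<longleftrightarrow> ?R")
proof
  assume ?L
  then show ?R
    by (auto simp: rpath_def bipath_def bitrail_snoc)
next
  assume R: ?R
  then have "oedge a \<notin> oedge ` set p"
    by (intro bipath_new_edge[of B r]) (auto simp: rpath_def)
  with R show ?L
    by (auto simp: rpath_def bipath_def bitrail_snoc)
qed

lemma rpath_last: "rpath A p v s \<Longrightarrow> last (trail_verts r p) = v"
  by (auto simp: rpath_def bipath_def dest: bitrail_imp(1))

lemma rpath_end_in: "rpath A p v s \<Longrightarrow> v \<in> set (trail_verts r p)"
  by (metis last_in_set rpath_last trail_verts_neq_Nil)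

lemma rpath_root: "rpath A p r s \<Longrightarrow> p = []"
  by (cases p rule: rev_cases) (auto simp: rpath_snoc)

lemma rpath_insert: "rpath (insert c A) p v s \<longleftrightarrow> rpath A p v s \<and> c \<notin> set (trail_verts r p)"
  by (auto simp: rpath_def)

lemma rpath_empty: "rpath A p v s \<Longrightarrow> rpath {} p v s"
  by (auto simp: rpath_def)

lemma rpath_through:
  assumes "rpath A p v s" "x \<in> set (trail_verts r p)"
  obtains q q' t where "p = q @ q'" "rpath A q x t"
proof -
  have "\<exists>q q' t. p = q @ q' \<and> rpath A q x t"
    using assms
  proof (induction p arbitrary: v s rule: rev_induct)
    case (snoc a p)
    show ?case
    proof (cases "x = v")
      case True
      with snoc.prems show ?thesis by blast
    next
      case False
      with snoc.prems have "rpath A p (otail a) (tsign B a)" "x \<in> set (trail_verts r p)"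
        by (auto simp: rpath_snoc)
      from snoc.IH[OF this] show ?thesis by (metis append.assoc)
    qed
  qed auto
  then show ?thesis using that by blast
qed

lemma reach_root: "r \<notin> A \<Longrightarrow> reach A r s"
  by (metis reach_def rpath_Nil)

lemma reach_empty: "reach A v s \<Longrightarrow> reach {} v s"
  unfolding reach_def using rpath_empty by blast

lemma reach_extend:
  assumes "rpath A p (otail a) (tsign B a)" "arc B a" "ohead a \<notin> set (trail_verts r p)" "ohead a \<notin> A"
  shows "reach A (ohead a) (opp (hsign B a))"
  using assms rpath_snoc[of A p a "ohead a" "opp (hsign B a)"] by (auto simp: reach_def)

lemma undir_sym: "undir A u v \<Longrightarrow> undir A v u"
  unfolding undir_def by (metis arc_reverse reverse_simps(1-3))

text \<open>An almost path without its last edge is a path to the tail; conversely, appending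
  \<open>a\<close> to a path cannot repeat an edge. From here on, traversing an edge is a question
  of \<open>reach\<close> at its tail.\<close>

lemma almost_path_via_iff:
  assumes "arc B a"
  shows "has_almost_path_via B r a \<longleftrightarrow> reach {} (otail a) (tsign B a)"
proof
  assume "has_almost_path_via B r a"
  then obtain p where "almost_path B r p (ohead a)" "p \<noteq> []" "last p = a"
    by (auto simp: has_almost_path_via_def)
  then obtain q w where q: "bitrail B r (q @ [a]) (ohead a)" "bipath B r q w"
    by (metis append_butlast_last_id almost_path_def)
  then have "bitrail B r q (otail a)" "q = [] \<or> tsign B a = opp (esign B (oedge (last q)) (otail a))"
    by (auto simp: bitrail_snoc)
  with q show "reach {} (otail a) (tsign B a)"
    by (auto simp: reach_def rpath_def bipath_def intro!: exI[of _ q])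
next
  assume "reach {} (otail a) (tsign B a)"
  then obtain p where p: "rpath {} p (otail a) (tsign B a)"
    by (auto simp: reach_def)
  then have "oedge a \<notin> oedge ` set p"
    using assms by (intro bipath_new_edge[of B r]) (auto simp: rpath_def)
  with p assms have "almost_path B r (p @ [a]) (ohead a)"
    by (auto simp: almost_path_def rpath_def bitrail_snoc bipath_def)
  then show "has_almost_path_via B r a"
    by (metis has_almost_path_via_def last_snoc snoc_eq_iff_butlast)
qed

text \<open>Cleanness enters here: appending \<open>a\<close> would give a nontrivial almost path
  from the root to itself.\<close>

lemma not_reach_into_root:
  assumes "arc B a" "ohead a = r"
  shows "\<not> reach A (otail a) (tsign B a)"
proof
  assume "reach A (otail a) (tsign B a)"
  then have "has_almost_path_via B r a"
    using assms(1) by (simp add: almost_path_via_iff reach_empty)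
  then show False
    using clean assms(2) by (auto simp: has_almost_path_via_def clean_def)
qed

lemma not_undir_root: "\<not> undir A u r"
  using not_reach_into_root by (auto simp: undir_def)

lemma not_undir_root_star: "(undir A)\<^sup>*\<^sup>* r v \<Longrightarrow> v = r"
  by (metis converse_rtranclpE not_undir_root undir_sym)

lemma undir_star_sym: "(undir A)\<^sup>*\<^sup>* u v \<Longrightarrow> (undir A)\<^sup>*\<^sup>* v u"
  by (induction rule: rtranclp_induct) (auto intro: undir_sym converse_rtranclp_into_rtranclp)

lemma reach_in_verts: "reach A v s \<Longrightarrow> v \<in> bverts B"
  unfolding reach_def
proof (elim exE)
  fix p assume "rpath A p v s"
  then show "v \<in> bverts B"
    using root_in_verts by (cases p rule: rev_cases) (auto simp: rpath_snoc dest: arc_in_verts)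
qed

lemma reach_not_in: "reach A v s \<Longrightarrow> v \<notin> A"
  unfolding reach_def
proof (elim exE)
  fix p assume "rpath A p v s"
  then show "v \<notin> A"
    by (cases p rule: rev_cases) (auto simp: rpath_snoc)
qed

lemma undir_in_verts: "undir A u v \<Longrightarrow> u \<in> bverts B"
  by (auto simp: undir_def dest: arc_in_verts)

lemma undir_star_in_verts: "(undir A)\<^sup>*\<^sup>* u v \<Longrightarrow> u \<in> bverts B \<Longrightarrow> v \<in> bverts B"
  by (induction rule: rtranclp_induct) (auto dest: undir_sym undir_in_verts)

text \<open>Follow a path to the head that avoids \<open>c\<close>. If it meets the tail, cut it
  there; otherwise append the reversed edge. This could only fail if the tail is \<open>c\<close>,
  but then \<open>c\<close> would be reachable with both signs.\<close>

lemma tail_reach_insert: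
  assumes c: "plain A c" and a: "arc B a"
    and tail: "reach A (otail a) (tsign B a)"
    and head: "reach (insert c A) (ohead a) (hsign B a)"
  shows "\<exists>s. reach (insert c A) (otail a) s"
proof -
  obtain q where q: "rpath (insert c A) q (ohead a) (hsign B a)"
    using head by (auto simp: reach_def)
  show ?thesis
  proof (cases "otail a \<in> set (trail_verts r q)")
    case True
    from rpath_through[OF q this] show ?thesis
      unfolding reach_def by blast
  next
    case False
    have ext: "reach A' (otail a) (opp (tsign B a))"
      if "rpath A' q (ohead a) (hsign B a)" "otail a \<notin> A'" for A'
      using reach_extend[of A' q "reverse a"] that a False by simp
    have "otail a \<noteq> c"
    proof
      assume eq: "otail a = c"
      have "reach A (otail a) (opp (tsign B a))"
        using q reach_not_in[OF tail] by (intro ext) (simp_all add: rpath_insert)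
      with tail have "reach A c s" for s
        unfolding eq by (rule sign_cases)
      with c show False
        by (simp add: plain_def)
    qed
    then show ?thesis
      using ext[OF q] reach_not_in[OF tail] by blast
  qed
qed

text \<open>
  A path may pass through \<open>c\<close>, but it gains nothing by that: at every vertex which is reachable
  without \<open>c\<close>, the path arrives in a way that is possible without \<open>c\<close>.
\<close>

lemma rpath_trace:
  assumes c: "plain A c"
    and unique: "\<And>x y. plain (insert c A) x \<Longrightarrow> plain (insert c A) y \<Longrightarrow>
      (undir (insert c A))\<^sup>*\<^sup>* x y \<Longrightarrow> x = y"
    and "rpath A p y s" "reach (insert c A) y t"
  shows "reach (insert c A) y s \<and>
    (\<forall>x. plain (insert c A) x \<and> (undir (insert c A))\<^sup>*\<^sup>* y x \<longrightarrow> x \<in> set (trail_verts r p))"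
  using assms(3,4)
proof (induction p arbitrary: y s t rule: rev_induct)
  case Nil
  then have "y = r" "r \<notin> insert c A"
    using reach_not_in by auto
  then show ?case
    by (auto simp: reach_root dest: not_undir_root_star)
next
  case (snoc a p)
  let ?A = "insert c A"
  from snoc.prems have p: "rpath A p (otail a) (tsign B a)" and a: "arc B a" "ohead a = y"
    and y: "y \<notin> set (trail_verts r p)" and s: "hsign B a = opp s"
    by (auto simp: rpath_snoc)
  have "y \<noteq> r"
    using y by auto
  \<comment> \<open>If \<open>y\<close> can be left backwards along \<open>a\<close> without
    \<open>c\<close>, the tail is reachable without \<open>c\<close> too. The induction hypothesis
    then makes \<open>a\<close> undirectable relative to \<open>?A\<close>, so the plain vertices in
    the component of \<open>y\<close> already lie on \<open>p\<close>.\<close>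
  have backward: "reach ?A (otail a) (tsign B a)"
    "\<And>x. plain ?A x \<Longrightarrow> (undir ?A)\<^sup>*\<^sup>* y x \<Longrightarrow> x \<in> set (trail_verts r p)"
    if h: "reach ?A y (hsign B a)"
  proof -
    have "reach A (otail a) (tsign B a)"
      using p by (auto simp: reach_def)
    then obtain t' where t': "reach ?A (otail a) t'"
      using tail_reach_insert[OF c a(1)] h a(2) by auto
    note IH = snoc.IH[OF p t']
    show 1: "reach ?A (otail a) (tsign B a)"
      using IH by blast
    have "undir ?A (otail a) y"
      unfolding undir_def using 1 h a by blast
    then show "x \<in> set (trail_verts r p)" if "plain ?A x" "(undir ?A)\<^sup>*\<^sup>* y x" for x
      using IH that by (meson converse_rtranclp_into_rtranclp)
  qed
  \<comment> \<open>Otherwise \<open>y\<close> is plain and its reachable sign \<open>t\<close> must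
    be the other one, that of \<open>a\<close>; then \<open>backward\<close> puts \<open>y\<close>
    itself on \<open>p\<close>.\<close>
  have ys: "reach ?A y s"
  proof (rule ccontr)
    assume "\<not> reach ?A y s"
    then have "plain ?A y" "reach ?A y (hsign B a)"
      using snoc.prems(2) \<open>y \<noteq> r\<close> sign_cases[of "\<lambda>u. reach ?A y u \<longrightarrow> reach ?A y (opp s)" s t]
      by (auto simp: plain_def s)
    then show False
      using backward(2) y by blast
  qed
  moreover have "x \<in> set (trail_verts r (p @ [a]))" if x: "plain ?A x" "(undir ?A)\<^sup>*\<^sup>* y x" for x
  proof (cases "reach ?A y (hsign B a)")
    case True
    then show ?thesis
      using backward(2) x by simp
  next
    \<comment> \<open>Here \<open>y\<close> is the unique plain vertex of its component, and it ends
      the path.\<close>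
    case False
    then have "plain ?A y"
      using \<open>y \<noteq> r\<close> by (auto simp: plain_def)
    then show ?thesis
      using unique x a by auto
  qed
  ultimately show ?case
    by blast
qed

text \<open>Unreachability without \<open>c\<close> spreads along undirectable edges: if the next
  vertex \<open>v\<close> were reachable without \<open>c\<close>, then by
  \<open>rpath_trace\<close> it could be left along the edge, and \<open>tail_reach_insert\<close>
  would reach \<open>w\<close> without \<open>c\<close>.\<close>

lemma undir_dominated:
  assumes c: "plain A c"
    and unique: "\<And>x y. plain (insert c A) x \<Longrightarrow> plain (insert c A) y \<Longrightarrow>
      (undir (insert c A))\<^sup>*\<^sup>* x y \<Longrightarrow> x = y"
    and star: "(undir A)\<^sup>*\<^sup>* c w"
  shows "\<not> reach (insert c A) w s"
  using star
proof (induction arbitrary: s rule: rtranclp_induct)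
  case base
  then show ?case
    using reach_not_in by blast
next
  case (step w v)
  show ?case
  proof
    assume v: "reach (insert c A) v s"
    obtain a where a: "arc B a" "otail a = w" "ohead a = v"
      and w: "reach A w (tsign B a)" and va: "reach A v (hsign B a)"
      using step.hyps(2) by (auto simp: undir_def)
    obtain p where "rpath A p v (hsign B a)"
      using va by (auto simp: reach_def)
    then have "reach (insert c A) v (hsign B a)"
      using rpath_trace[OF c unique _ v] by blast
    then show False
      using tail_reach_insert[OF c a(1)] a w step.IH by blast
  qed
qed

lemma plain_unique:
  assumes "plain A c" "plain A d" "(undir A)\<^sup>*\<^sup>* c d"
  shows "c = d"
  using assms
proof (induction "card (bverts B - A)" arbitrary: A c d rule: less_induct)
  case less
  show ?case
  proof (rule ccontr)
    assume "c \<noteq> d"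
    \<comment> \<open>A walk between distinct vertices begins with an undirectable edge at
      \<open>x\<close>, so \<open>x\<close> is reachable and lies in \<open>bverts B - A\<close>.
      This must be shown before the measure can drop, as unreachable vertices count as
      plain.\<close>
    have dom: "\<And>s. \<not> reach (insert x A) y s" "\<exists>s. reach A x s"
      if x: "plain A x" and star: "(undir A)\<^sup>*\<^sup>* x y" and neq: "x \<noteq> y" for x y
    proof -
      obtain z where z: "undir A x z"
        using star neq by (blast elim: converse_rtranclpE)
      then show "\<exists>s. reach A x s"
        by (auto simp: undir_def)
      then have "x \<in> bverts B - A"
        using reach_in_verts reach_not_in by blast
      then have smaller: "card (bverts B - insert x A) < card (bverts B - A)"
        using finite_bverts by (intro psubset_card_mono) auto
      show "\<not> reach (insert x A) y s" for s
        by (rule undir_dominated[OF x less.hyps[OF smaller] star])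
    qed
    note cd = dom[OF less.prems(1,3) \<open>c \<noteq> d\<close>]
    note dc = dom(1)[OF less.prems(2) undir_star_sym[OF less.prems(3)] \<open>c \<noteq> d\<close>[symmetric]]
    obtain p s where p: "rpath A p c s"
      using cd(2) by (auto simp: reach_def)
    then have "d \<in> set (trail_verts r p)"
      using dc[of s] by (auto simp: reach_def rpath_insert)
    from rpath_through[OF p this] obtain q q' t where q: "p = q @ q'" "rpath A q d t" .
    have "c \<in> set (trail_verts r q)"
      using cd(1)[of t] q(2) by (auto simp: reach_def rpath_insert)
    moreover have "c \<in> ohead ` set q'"
    proof (cases q' rule: rev_cases)
      case Nil
      then show ?thesis
        using \<open>c \<noteq> d\<close> q(1) rpath_last[OF p] rpath_last[OF q(2)] by simp
    next
      case (snoc q'' a)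
      then show ?thesis
        using q(1) rpath_last[OF p] by simp
    qed
    ultimately show False
      using p q(1) by (auto simp: rpath_def bipath_def)
  qed
qed

section \<open>The projection to the skeleton\<close>

text \<open>Within \<open>bverts B\<close> these are the vertices of the skeleton, see
  \<open>verts_skeleton\<close>.\<close>

definition special :: "'v \<Rightarrow> bool" where
  "special v \<longleftrightarrow> v = r \<or> plain {} v"

lemma special_unique:
  assumes "special c" "special d" "(undir {})\<^sup>*\<^sup>* c d"
  shows "c = d"
  using assms plain_unique not_undir_root_star undir_star_sym unfolding special_def by metis

lemma special_if_not_reach: "u \<noteq> r \<Longrightarrow> \<not> reach {} u s \<Longrightarrow> special u"
  by (auto simp: special_def plain_def)

text \<open>All paths to such a vertex arrive with the same sign, so they can replace each other as
  initial segments.\<close>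

lemma special_reach_unique:
  assumes "special c" "c \<noteq> r" "reach {} c s" "reach {} c t"
  shows "s = t"
proof -
  obtain u where "\<not> reach {} c u"
    using assms(1,2) by (auto simp: special_def plain_def)
  with assms(3,4) show ?thesis
    by (cases s; cases t; cases u) auto
qed

text \<open>If the last edge cannot be traversed backwards, its head misses a sign and is
  plain.\<close>

lemma rpath_undir_cases:
  assumes "rpath {} (p @ [a]) v s"
  shows "undir {} (otail a) v \<or> special v \<and> v \<noteq> r \<and> \<not> reach {} v (hsign B a)"
proof -
  have a: "rpath {} p (otail a) (tsign B a)" "arc B a" "ohead a = v" "v \<notin> set (trail_verts r p)"
    using assms by (auto simp: rpath_snoc)
  then have "v \<noteq> r" by auto
  have "reach {} (otail a) (tsign B a)"
    using a(1) by (auto simp: reach_def)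
  with a(2,3) have "undir {} (otail a) v" if "reach {} v (hsign B a)"
    using that unfolding undir_def by blast
  with \<open>v \<noteq> r\<close> show ?thesis
    using special_if_not_reach by blast
qed

text \<open>Go back along a path from the root: undirectable edges stay in the component, and the
  first other edge met has a special head. If there is none, the root is reached.\<close>

lemma ex_special:
  assumes "reach {} v s"
  shows "\<exists>c. (undir {})\<^sup>*\<^sup>* v c \<and> special c"
proof -
  have "\<exists>c. (undir {})\<^sup>*\<^sup>* v c \<and> special c" if "rpath {} p v s" for p
    using that
  proof (induction p arbitrary: v s rule: rev_induct)
    case Nil
    then show ?case by (auto simp: special_def)
  next
    case (snoc a p)
    have IH: "\<exists>c. (undir {})\<^sup>*\<^sup>* (otail a) c \<and> special c"
      using snoc.IH snoc.prems unfolding rpath_snoc by blast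
    from rpath_undir_cases[OF snoc.prems] show ?case
    proof
      assume "undir {} (otail a) v"
      with IH show ?thesis
        by (meson converse_rtranclp_into_rtranclp undir_sym)
    qed blast
  qed
  with assms show ?thesis
    by (auto simp: reach_def)
qed

section \<open>Agreement with the definitions of components and projection\<close>

lemma undirectable_iff:
  assumes "arc B a"
  shows "undirectable B r (oedge a) \<longleftrightarrow> reach {} (otail a) (tsign B a) \<and> reach {} (ohead a) (hsign B a)"
proof -
  have a: "a \<in> orientations B (oedge a)"
    using assms by (auto simp: arc_def orientations_iff)
  have "undirectable B r (oedge a) \<longleftrightarrow> has_almost_path_via B r a \<and> has_almost_path_via B r (reverse a)"
    unfolding undirectable_def using a orientations_cases[OF a] by (metis reverse_simps(4))
  then show ?thesis
    using assms almost_path_via_iff[of a] almost_path_via_iff[of "reverse a"] by simp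
qed

lemma undirectable_adj_iff: "(u, v) \<in> undirectable_adj B r \<longleftrightarrow> undir {} u v"
proof
  assume "(u, v) \<in> undirectable_adj B r"
  then obtain e where "e \<in> bedges B" "undirectable B r e" "ends B e = {u, v}"
    by (auto simp: undirectable_adj_def undirectable_edges_def)
  then have "arc B (u, e, v)" "undirectable B r (oedge (u, e, v))"
    by (auto simp: arc_def)
  then show "undir {} u v"
    unfolding undirectable_iff[OF \<open>arc B (u, e, v)\<close>] undir_def by force
next
  assume "undir {} u v"
  then obtain a where "arc B a" "undirectable B r (oedge a)" "otail a = u" "ohead a = v"
    by (auto simp: undir_def undirectable_iff)
  then show "(u, v) \<in> undirectable_adj B r"
    by (auto simp: undirectable_adj_def undirectable_edges_def arc_def)
qed

lemma undirectable_adj_star: "(u, v) \<in> (undirectable_adj B r)\<^sup>* \<longleftrightarrow> (undir {})\<^sup>*\<^sup>* u v"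
proof -
  have "undirectable_adj B r = {(u, v). undir {} u v}"
    using undirectable_adj_iff by auto
  then show ?thesis
    by (simp add: rtranclp_rtrancl_eq)
qed

lemma covered_iff: "w \<in> (\<Union>e \<in> undirectable_edges B r. ends B e) \<longleftrightarrow> (\<exists>v. undir {} w v)"
proof
  assume "w \<in> (\<Union>e \<in> undirectable_edges B r. ends B e)"
  then obtain e where e: "e \<in> undirectable_edges B r" "w \<in> ends B e"
    by auto
  then have "card (ends B e) = 2"
    using two_ends by (auto simp: undirectable_edges_def)
  with e(2) obtain v where "ends B e = {w, v}"
    by (auto simp: card_2_iff) (metis insert_commute)
  then have "(w, v) \<in> undirectable_adj B r"
    using e(1) by (auto simp: undirectable_adj_def)
  then show "\<exists>v. undir {} w v"
    using undirectable_adj_iff by blast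
next
  assume "\<exists>v. undir {} w v"
  then obtain v where "(w, v) \<in> undirectable_adj B r"
    using undirectable_adj_iff by auto
  then show "w \<in> (\<Union>e \<in> undirectable_edges B r. ends B e)"
    by (auto simp: undirectable_adj_def)
qed

text \<open>By the symmetry \<open>undir_star_sym\<close>, a class of the quotient can be described
  from any of its members.\<close>

lemma component_iff:
  "C \<in> undirectable_components B r \<and> w \<in> C \<longleftrightarrow> C = {v. (undir {})\<^sup>*\<^sup>* w v} \<and> (\<exists>v. undir {} w v)"
proof
  assume "C \<in> undirectable_components B r \<and> w \<in> C"
  then obtain z where z: "z \<in> (\<Union>e \<in> undirectable_edges B r. ends B e)"
    and "C = (undirectable_adj B r)\<^sup>* `` {z}" and "w \<in> C"
    unfolding undirectable_components_def by (blast elim: quotientE)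
  then have C: "C = {v. (undir {})\<^sup>*\<^sup>* z v}" and "(undir {})\<^sup>*\<^sup>* z w"
    by (auto simp: undirectable_adj_star)
  moreover obtain y where "undir {} z y"
    using z covered_iff by blast
  ultimately have "\<exists>v. undir {} w v"
    by (metis rtranclp.cases undir_sym)
  moreover have "C = {v. (undir {})\<^sup>*\<^sup>* w v}"
    using C \<open>(undir {})\<^sup>*\<^sup>* z w\<close> undir_star_sym by (auto intro: rtranclp_trans)
  ultimately show "C = {v. (undir {})\<^sup>*\<^sup>* w v} \<and> (\<exists>v. undir {} w v)"
    by blast
next
  assume *: "C = {v. (undir {})\<^sup>*\<^sup>* w v} \<and> (\<exists>v. undir {} w v)"
  then have "C = (undirectable_adj B r)\<^sup>* `` {w}"
    by (auto simp: undirectable_adj_star)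
  moreover have "w \<in> (\<Union>e \<in> undirectable_edges B r. ends B e)"
    using * covered_iff by blast
  ultimately have "C \<in> undirectable_components B r"
    unfolding undirectable_components_def by (metis quotientI)
  with * show "C \<in> undirectable_components B r \<and> w \<in> C"
    by blast
qed

lemma plain_verts_iff: "v \<in> plain_verts B r \<longleftrightarrow> v \<in> bverts B \<and> plain {} v"
proof -
  have "has_signed_path B r v \<alpha> \<longleftrightarrow> reach {} v (opp \<alpha>)" if "v \<noteq> r" for \<alpha>
  proof -
    have "p \<noteq> []" if "bipath B r p v" for p
      using that \<open>v \<noteq> r\<close> by (auto simp: bipath_def)
    then show ?thesis
      by (auto simp: has_signed_path_def reach_def rpath_def)
  qed
  then show ?thesis
    by (auto simp: plain_verts_def plain_def) (metis opp_opp)+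
qed

text \<open>The last edge of a path to \<open>w\<close> must be undirectable by
  \<open>rpath_undir_cases\<close>. Thus vertices outside all components are special.\<close>

lemma nonspecial_undir:
  assumes "\<not> special w"
  shows "\<exists>v. undir {} w v"
proof -
  have w: "w \<noteq> r" "\<And>s. reach {} w s"
    using assms by (auto simp: special_def plain_def)
  obtain p where p: "rpath {} p w Plus"
    using w(2) by (auto simp: reach_def)
  then show ?thesis
  proof (cases p rule: rev_cases)
    case (snoc q a)
    with p rpath_undir_cases assms show ?thesis
      using undir_sym by blast
  qed (use w in auto)
qed

text \<open>Both definite descriptions are meaningful: \<open>component_iff\<close> determines the
  component, \<open>ex_special\<close> and \<open>special_unique\<close> its root.\<close>

lemma skeleton_proj_special:
  assumes "w \<in> bverts B"
  shows "(undir {})\<^sup>*\<^sup>* w (skeleton_proj B r w) \<and> special (skeleton_proj B r w)"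
proof (cases "\<exists>v. undir {} w v")
  case True
  define C where "C = {v. (undir {})\<^sup>*\<^sup>* w v}"
  have C: "C' \<in> undirectable_components B r \<and> w \<in> C' \<longleftrightarrow> C' = C" for C'
    unfolding component_iff C_def using True by blast
  have "c \<in> bverts B" if "c \<in> C" for c
    using that assms undir_star_in_verts by (auto simp: C_def)
  then have "c \<in> C \<and> c \<in> plain_verts B r \<union> {r} \<longleftrightarrow> (undir {})\<^sup>*\<^sup>* w c \<and> special c" for c
    by (auto simp: plain_verts_iff special_def C_def)
  moreover have "\<exists>C' \<in> undirectable_components B r. w \<in> C'"
    using C by blast
  ultimately have "skeleton_proj B r w = (THE c. (undir {})\<^sup>*\<^sup>* w c \<and> special c)"
    by (simp add: skeleton_proj_def C component_root_def)
  moreover have "\<exists>!c. (undir {})\<^sup>*\<^sup>* w c \<and> special c"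
  proof (rule ex_ex1I)
    show "\<exists>c. (undir {})\<^sup>*\<^sup>* w c \<and> special c"
      using True ex_special by (auto simp: undir_def)
    show "c = d" if "(undir {})\<^sup>*\<^sup>* w c \<and> special c" "(undir {})\<^sup>*\<^sup>* w d \<and> special d" for c d
      using that special_unique undir_star_sym by (meson rtranclp_trans)
  qed
  ultimately show ?thesis
    by (metis (mono_tags, lifting) theI')
next
  case False
  then have "\<not> (\<exists>C \<in> undirectable_components B r. w \<in> C)"
    using component_iff by blast
  then have "skeleton_proj B r w = w"
    by (simp add: skeleton_proj_def)
  with False show ?thesis
    using nonspecial_undir by auto
qed

lemma skeleton_proj_eqI:
  assumes "w \<in> bverts B" "(undir {})\<^sup>*\<^sup>* w c" "special c"
  shows "skeleton_proj B r w = c"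
  using skeleton_proj_special[OF assms(1)] assms(2,3) special_unique undir_star_sym
  by (meson rtranclp_trans)

lemma skeleton_proj_id: "w \<in> bverts B \<Longrightarrow> special w \<Longrightarrow> skeleton_proj B r w = w"
  by (simp add: skeleton_proj_eqI)

lemma skeleton_proj_in_verts:
  assumes "w \<in> bverts B"
  shows "skeleton_proj B r w \<in> bverts B"
  using skeleton_proj_special[OF assms] assms undir_star_in_verts by blast

lemma skeleton_proj_undir: "undir {} u v \<Longrightarrow> skeleton_proj B r u = skeleton_proj B r v"
  by (meson converse_rtranclp_into_rtranclp skeleton_proj_eqI skeleton_proj_special undir_in_verts undir_sym)

lemma skeleton_proj_root_iff:
  assumes "w \<in> bverts B"
  shows "skeleton_proj B r w = r \<longleftrightarrow> w = r"
  using skeleton_proj_special[OF assms] not_undir_root_star undir_star_sym skeleton_proj_id[OF assms]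
  by (metis special_def)

lemma verts_skeleton: "verts (skeleton B r) = {v \<in> bverts B. special v}"
  using skeleton_proj_in_verts skeleton_proj_special skeleton_proj_id
  by (auto simp: skeleton_def image_iff) metis

text \<open>The only other orientation is \<open>reverse a\<close>, which differs from
  \<open>a\<close> as there are no loops. So uniqueness means that the edge cannot be traversed from
  its head.\<close>

lemma directable_iff:
  assumes a: "arc B a" and tail: "reach {} (otail a) (tsign B a)"
  shows "directable B r (oedge a) \<longleftrightarrow> \<not> reach {} (ohead a) (hsign B a)"
    and "\<not> reach {} (ohead a) (hsign B a) \<Longrightarrow> natural_orientation B r (oedge a) = a"
proof -
  define Q where "Q b \<longleftrightarrow> b \<in> orientations B (oedge a) \<and> has_almost_path_via B r b" for b
  have ori: "a \<in> orientations B (oedge a)" "reverse a \<in> orientations B (oedge a)"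
    using a by (auto simp: arc_def orientations_iff)
  have Qa: "Q a"
    using almost_path_via_iff[OF a] tail ori by (simp add: Q_def)
  have rev: "Q (reverse a) \<longleftrightarrow> reach {} (ohead a) (hsign B a)"
    using almost_path_via_iff[of "reverse a"] a ori by (simp add: Q_def)
  have neq: "reverse a \<noteq> a"
    using arc_ends_neq[OF a] by (metis reverse_simps(1))
  have Q: "b = a \<or> b = reverse a" if "Q b" for b
    using that orientations_cases[OF ori(1)] by (simp add: Q_def)
  show "directable B r (oedge a) \<longleftrightarrow> \<not> reach {} (ohead a) (hsign B a)"
    unfolding directable_def Q_def[symmetric] rev[symmetric] using Qa neq Q by blast
  show "natural_orientation B r (oedge a) = a" if "\<not> reach {} (ohead a) (hsign B a)"
    unfolding natural_orientation_def Q_def[symmetric]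
    using Qa rev that Q by (intro the_equality) blast+
qed

text \<open>The head cannot be left along the edge, so it is special and fixed by the projection;
  only the tail may move.\<close>

lemma arcs_skeletonE:
  assumes "e \<in> arcs (skeleton B r)"
  obtains a where "arc B a" "oedge a = e" "reach {} (otail a) (tsign B a)"
    "\<not> reach {} (ohead a) (hsign B a)"
    "tail (skeleton B r) e = skeleton_proj B r (otail a)" "head (skeleton B r) e = ohead a"
    "special (ohead a)" "ohead a \<noteq> r" "directable B r e"
proof -
  have e: "e \<in> bedges B" "directable B r e"
    using assms by (auto simp: skeleton_def)
  then obtain a where a: "a \<in> orientations B e" "has_almost_path_via B r a"
    unfolding directable_def by blast
  then have a': "arc B a" "oedge a = e"
    using e(1) by (auto simp: orientations_iff arc_def)
  then have tail: "reach {} (otail a) (tsign B a)"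
    using almost_path_via_iff a(2) by simp
  have head: "\<not> reach {} (ohead a) (hsign B a)"
    using directable_iff(1)[OF a'(1) tail] e(2) a'(2) by simp
  have "natural_orientation B r e = a"
    using directable_iff(2)[OF a'(1) tail head] a'(2) by simp
  moreover have "ohead a \<noteq> r"
    using head reach_root by auto
  moreover have "special (ohead a)"
    using special_if_not_reach head \<open>ohead a \<noteq> r\<close> by blast
  ultimately show thesis
    using that[of a] a' tail head e arc_in_verts[OF a'(1)] skeleton_proj_id
    by (simp add: skeleton_def)
qed

lemma arc_skeletonI:
  assumes "arc B a" "reach {} (otail a) (tsign B a)" "\<not> reach {} (ohead a) (hsign B a)"
  shows "oedge a \<in> arcs (skeleton B r)" "directable B r (oedge a)"
    "tail (skeleton B r) (oedge a) = skeleton_proj B r (otail a)"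
    "head (skeleton B r) (oedge a) = skeleton_proj B r (ohead a)"
  using directable_iff[OF assms(1,2)] assms by (auto simp: skeleton_def arc_def)

lemma wf_skeleton: "wf_digraph (skeleton B r)"
proof
  fix e assume "e \<in> arcs (skeleton B r)"
  then obtain a where a: "arc B a" "tail (skeleton B r) e = skeleton_proj B r (otail a)"
    "head (skeleton B r) e = ohead a" "special (ohead a)"
    by (rule arcs_skeletonE)
  then show "tail (skeleton B r) e \<in> verts (skeleton B r)" "head (skeleton B r) e \<in> verts (skeleton B r)"
    using arc_in_verts[OF a(1)] by (simp_all add: verts_skeleton skeleton_proj_in_verts skeleton_proj_special)
qed

section \<open>Projecting and lifting paths\<close>

text \<open>The skeleton keeps the names of edges, so contracting the components turns a path into a
  sublist.\<close>

abbreviation proj_path :: "('v, 'e) oedge list \<Rightarrow> 'e list" where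
  "proj_path p \<equiv> filter (directable B r) (map oedge p)"

lemma rpath_last_edge:
  assumes "rpath {} (p @ [a]) v s"
  shows "reach {} v (hsign B a) \<and> undir {} (otail a) v \<and> \<not> directable B r (oedge a) \<or>
    \<not> reach {} v (hsign B a) \<and> special v \<and> v \<noteq> r \<and> directable B r (oedge a)"
proof -
  have a: "arc B a" "reach {} (otail a) (tsign B a)" "ohead a = v" "v \<noteq> r"
    using assms by (auto simp: rpath_snoc reach_def)
  then show ?thesis
    using directable_iff(1)[OF a(1,2)] special_if_not_reach[of v] unfolding undir_def by blast
qed

text \<open>Every arc of the projection ends at an actual vertex of \<open>p\<close>. The inclusion
  of vertex sets, proved simultaneously, excludes repeated vertices.\<close>

lemma rpath_proj:
  assumes "rpath {} p v s"
  shows "pre_digraph.apath (skeleton B r) r (proj_path p) (skeleton_proj B r v) \<and>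
    set (pre_digraph.awalk_verts (skeleton B r) r (proj_path p)) \<subseteq> set (trail_verts r p)"
  using assms
proof (induction p arbitrary: v s rule: rev_induct)
  case Nil
  interpret D: wf_digraph "skeleton B r" by (rule wf_skeleton)
  have "special r"
    by (simp add: special_def)
  with Nil root_in_verts show ?case
    by (simp add: D.apath_Nil_iff verts_skeleton skeleton_proj_id)
next
  case (snoc a p)
  interpret D: wf_digraph "skeleton B r" by (rule wf_skeleton)
  have p: "rpath {} p (otail a) (tsign B a)" and a: "arc B a" "ohead a = v" "v \<notin> set (trail_verts r p)"
    using snoc.prems by (auto simp: rpath_snoc)
  note IH = snoc.IH[OF p]
  from rpath_last_edge[OF snoc.prems] show ?case
  proof
    assume "reach {} v (hsign B a) \<and> undir {} (otail a) v \<and> \<not> directable B r (oedge a)"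
    then show ?thesis
      using IH skeleton_proj_undir by auto
  next
    assume v: "\<not> reach {} v (hsign B a) \<and> special v \<and> v \<noteq> r \<and> directable B r (oedge a)"
    have "reach {} (otail a) (tsign B a)"
      using p by (auto simp: reach_def)
    note arc = arc_skeletonI[OF a(1) this] and v' = skeleton_proj_id[of v]
    have vv: "skeleton_proj B r v = v"
      using v' v arc_in_verts[OF a(1)] a(2) by simp
    have ap: "D.apath r (proj_path p @ [oedge a]) v"
      unfolding D.apath_snoc_iff using IH arc a v vv by auto
    show ?thesis
      using ap D.awalk_verts_snoc[OF ap] IH v vv arc a by auto
  qed
qed

text \<open>Going back from \<open>u\<close>, the path stays in the component until a directable
  edge enters it, at its special vertex, or the root is reached.\<close>

lemma rpath_split:
  assumes "rpath {} p u s"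
  shows "\<exists>p1 p2 t. p = p1 @ p2 \<and> rpath {} p1 (skeleton_proj B r u) t \<and>
    (\<forall>a \<in> set p2. \<not> directable B r (oedge a) \<and> skeleton_proj B r (ohead a) = skeleton_proj B r u)"
  using assms
proof (induction p arbitrary: u s rule: rev_induct)
  case Nil
  then show ?case
    using root_in_verts by (auto simp: skeleton_proj_root_iff)
next
  case (snoc a p)
  have p: "rpath {} p (otail a) (tsign B a)" and a: "arc B a" "ohead a = u"
    using snoc.prems by (auto simp: rpath_snoc)
  from rpath_last_edge[OF snoc.prems] show ?case
  proof
    assume u: "reach {} u (hsign B a) \<and> undir {} (otail a) u \<and> \<not> directable B r (oedge a)"
    then have eq: "skeleton_proj B r (otail a) = skeleton_proj B r u"
      using skeleton_proj_undir by blast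
    obtain p1 p2 t where "p = p1 @ p2" "rpath {} p1 (skeleton_proj B r u) t"
      "\<forall>a \<in> set p2. \<not> directable B r (oedge a) \<and> skeleton_proj B r (ohead a) = skeleton_proj B r u"
      using snoc.IH[OF p] unfolding eq by blast
    then show ?thesis
      using u a by (intro exI[of _ p1] exI[of _ "p2 @ [a]"] exI[of _ t]) auto
  next
    assume "\<not> reach {} u (hsign B a) \<and> special u \<and> u \<noteq> r \<and> directable B r (oedge a)"
    then have "skeleton_proj B r u = u"
      using skeleton_proj_id arc_in_verts[OF a(1)] a(2) by simp
    then show ?thesis
      using snoc.prems by (intro exI[of _ "p @ [a]"] exI[of _ "[]"] exI[of _ s]) auto
  qed
qed

text \<open>The sign wanted at the junction is that of the first edge of \<open>p2\<close>, which
  need not be \<open>t\<close> if \<open>p1\<close> is trivial. So \<open>q\<close> has to allow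
  every continuation that \<open>p1\<close> allows.\<close>

lemma rpath_replace_prefix:
  assumes "rpath A (p1 @ p2) u s" "rpath A p1 c t"
    and q: "\<And>t. rpath A p1 c t \<Longrightarrow> rpath A q c t"
    and disj: "ohead ` set p2 \<inter> set (trail_verts r q) = {}"
  shows "rpath A (q @ p2) u s"
  using assms(1) disj
proof (induction p2 arbitrary: u s rule: rev_induct)
  case Nil
  then have "u = c"
    using rpath_last[OF assms(2)] rpath_last[OF Nil(1)] by simp
  with Nil q show ?case by simp
next
  case (snoc a p2)
  then have "rpath A ((p1 @ p2) @ [a]) u s"
    by simp
  then have "rpath A (q @ p2) (otail a) (tsign B a)" "arc B a" "ohead a = u"
    "u \<notin> set (trail_verts r (p1 @ p2))" "u \<notin> A" "hsign B a = opp s"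
    using snoc unfolding rpath_snoc by auto
  then have "rpath A ((q @ p2) @ [a]) u s"
    using snoc.prems(2) unfolding rpath_snoc by auto
  then show ?case by simp
qed

text \<open>The last two conjuncts strengthen the induction: the lift visits only components on the
  directed path, and in the last one only the vertex \<open>y\<close>. This leaves room for a
  segment inside that component before the next edge.\<close>

lemma apath_lift:
  assumes "pre_digraph.apath (skeleton B r) r p y"
  shows "\<exists>q s. rpath {} q y s \<and> proj_path q = p \<and>
    skeleton_proj B r ` set (trail_verts r q) \<subseteq> set (pre_digraph.awalk_verts (skeleton B r) r p) \<and>
    (\<forall>v \<in> set (trail_verts r q). skeleton_proj B r v = y \<longrightarrow> v = y)"
  using assms
proof (induction p arbitrary: y rule: rev_induct)
  case Nil
  interpret D: wf_digraph "skeleton B r" by (rule wf_skeleton)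
  have "y = r"
    using Nil by (simp add: D.apath_Nil_iff)
  then show ?case
    using root_in_verts by (intro exI[of _ "[]"]) (simp add: skeleton_proj_root_iff)
next
  case (snoc e p)
  interpret D: wf_digraph "skeleton B r" by (rule wf_skeleton)
  let ?\<pi> = "skeleton_proj B r" and ?V = "set (D.awalk_verts r p)"
  have e: "e \<in> arcs (skeleton B r)" and p: "D.apath r p (tail (skeleton B r) e)"
    and y: "head (skeleton B r) e = y" "y \<notin> ?V"
    using snoc.prems by (auto simp: D.apath_snoc_iff)
  from e obtain a where a: "arc B a" "oedge a = e" "reach {} (otail a) (tsign B a)"
    "\<not> reach {} (ohead a) (hsign B a)" "tail (skeleton B r) e = ?\<pi> (otail a)"
    "head (skeleton B r) e = ohead a" "special (ohead a)" "ohead a \<noteq> r" "directable B r e"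
    by (rule arcs_skeletonE)
  define c where "c = ?\<pi> (otail a)"
  have c: "special c"
    using skeleton_proj_special arc_in_verts[OF a(1)] by (simp add: c_def)
  have "c \<in> ?V"
    using p last_in_set[OF D.awalk_verts_non_Nil, of r p] unfolding a(5) c_def[symmetric]
    by (auto simp: D.apath_def)
  obtain q s where q: "rpath {} q c s" "proj_path q = p" "?\<pi> ` set (trail_verts r q) \<subseteq> ?V"
    "\<forall>v \<in> set (trail_verts r q). ?\<pi> v = c \<longrightarrow> v = c"
    using snoc.IH[OF p] unfolding a(5) c_def[symmetric] by blast
  \<comment> \<open>Only the end \<open>p2\<close> of this path, which runs inside the component of
    \<open>c\<close>, is kept; its initial part \<open>p1\<close> gives way to
    \<open>q\<close>.\<close>
  obtain p0 where p0: "rpath {} p0 (otail a) (tsign B a)"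
    using a(3) by (auto simp: reach_def)
  from rpath_split[OF p0] obtain p1 p2 t where p12: "p0 = p1 @ p2" "rpath {} p1 c t"
    "\<forall>a \<in> set p2. \<not> directable B r (oedge a) \<and> ?\<pi> (ohead a) = c"
    unfolding c_def by blast
  \<comment> \<open>A path to the root is trivial; elsewhere all paths to \<open>c\<close> arrive
    with one sign.\<close>
  have q1: "rpath {} q c t'" if "rpath {} p1 c t'" for t'
  proof (cases "c = r")
    case True
    then show ?thesis
      using q(1) that rpath_root[of "{}" q s] rpath_root[of "{}" p1 t'] by auto
  next
    case False
    then have "s = t'"
      using special_reach_unique c q(1) that unfolding reach_def by blast
    with q(1) show ?thesis by simp
  qed
  \<comment> \<open>Vertices of \<open>p2\<close> project to \<open>c\<close>. The only such vertex
    on \<open>q\<close> is \<open>c\<close>, which \<open>p0\<close> has visited before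
    \<open>p2\<close>.\<close>
  have disj: "ohead ` set p2 \<inter> set (trail_verts r q) = {}"
  proof -
    have "c \<notin> ohead ` set p2"
      using p0 rpath_end_in[OF p12(2)] by (auto simp: rpath_def bipath_def p12(1))
    then show ?thesis
      using q(4) p12(3) by blast
  qed
  have q2: "rpath {} (q @ p2) (otail a) (tsign B a)"
    using rpath_replace_prefix[OF p0[unfolded p12(1)] p12(2) q1 disj] .
  have V: "?\<pi> v \<in> ?V" if v: "v \<in> set (trail_verts r (q @ p2))" for v
  proof (cases "v \<in> set (trail_verts r q)")
    case True
    with q(3) show ?thesis by blast
  next
    case False
    with v obtain b where "b \<in> set p2" "v = ohead b"
      by auto
    then show ?thesis
      using p12(3) \<open>c \<in> ?V\<close> by simp
  qed
  have a': "ohead a = y"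
    using y(1) a(6) by simp
  have \<pi>y: "?\<pi> y = y"
    using a' a(7) arc_in_verts[OF a(1)] skeleton_proj_id[of y] by simp
  have "y \<notin> set (trail_verts r (q @ p2))"
    using V[of y] y(2) \<pi>y by auto
  then have path: "rpath {} ((q @ p2) @ [a]) y (opp (hsign B a))"
    unfolding rpath_snoc using q2 a(1) a' by simp
  have "proj_path p2 = []"
    using p12(3) by (simp add: filter_empty_conv)
  then have proj: "proj_path ((q @ p2) @ [a]) = p @ [e]"
    using q(2) a(2,9) by simp
  have verts: "set (trail_verts r ((q @ p2) @ [a])) = insert y (set (trail_verts r (q @ p2)))"
    using a' by simp
  have "?\<pi> ` insert y (set (trail_verts r (q @ p2))) \<subseteq> insert y ?V"
    using V \<pi>y by blast
  also have "insert y ?V = set (D.awalk_verts r (p @ [e]))"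
    unfolding D.awalk_verts_snoc[OF snoc.prems] y(1) by simp
  finally have sub: "?\<pi> ` set (trail_verts r ((q @ p2) @ [a])) \<subseteq> set (D.awalk_verts r (p @ [e]))"
    unfolding verts .
  have y_only: "\<forall>v \<in> set (trail_verts r ((q @ p2) @ [a])). ?\<pi> v = y \<longrightarrow> v = y"
    unfolding verts using V y(2) by blast
  show ?case
    by (rule exI, rule exI, intro conjI, rule path, rule proj, rule sub, rule y_only)
qed

section \<open>Families of internally disjoint paths\<close>

lemma bipath_rpath: "bipath B r p x \<Longrightarrow> \<exists>s. rpath {} p x s"
  unfolding rpath_def by (metis inf_bot_right opp_opp)

lemma rpath_bipath: "rpath A p x s \<Longrightarrow> bipath B r p x"
  by (simp add: rpath_def)

lemma rpath_prefix: "rpath A (p @ q) v s \<Longrightarrow> \<exists>w t. rpath A p w t"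
proof (induction q arbitrary: v s rule: rev_induct)
  case (snoc a q)
  then have "rpath A ((p @ q) @ [a]) v s"
    by simp
  then show ?case
    using snoc.IH unfolding rpath_snoc by blast
qed auto

text \<open>No undirectable edge meets the root, so the first edge survives the projection.\<close>

lemma rpath_first_edge:
  assumes "rpath {} p x s" "x \<noteq> r"
  obtains a p' where "p = a # p'" "arc B a" "otail a = r" "ohead a \<noteq> r" "directable B r (oedge a)"
proof (cases p)
  case Nil
  with assms show thesis by simp
next
  case (Cons a p')
  then have "rpath {} ([a] @ p') x s"
    using assms(1) by simp
  then obtain w t where w: "rpath {} [a] w t"
    using rpath_prefix by blast
  then have w': "rpath {} ([] @ [a]) w t"
    by simp
  then have "arc B a" "otail a = r" "ohead a \<noteq> r"
    unfolding rpath_snoc by auto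
  moreover from this have "directable B r (oedge a)"
    using rpath_last_edge[OF w'] not_undir_root undir_sym by metis
  ultimately show thesis
    using that Cons by blast
qed

text \<open>The projection forgets undirectable edges, and disjointness compensates: both paths have
  the same directable first edge, whose head must be \<open>x\<close>, where both end.\<close>

lemma rpath_inj_proj:
  assumes p: "rpath {} p x s" and q: "rpath {} q x t" and "x \<noteq> r"
    and disj: "disjnt (set (trail_verts r p) - {r, x}) (set (trail_verts r q) - {r, x})"
    and eq: "proj_path p = proj_path q"
  shows "p = q"
proof -
  obtain a p' where a: "p = a # p'" "arc B a" "otail a = r" "ohead a \<noteq> r" "directable B r (oedge a)"
    using rpath_first_edge[OF p \<open>x \<noteq> r\<close>] .
  obtain b q' where b: "q = b # q'" "arc B b" "otail b = r" "ohead b \<noteq> r" "directable B r (oedge b)"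
    using rpath_first_edge[OF q \<open>x \<noteq> r\<close>] .
  have "oedge a = oedge b"
    using eq a b by simp
  then have "ohead a = ohead b"
    using a b by (auto simp: arc_def doubleton_eq_iff)
  then have "a = b"
    using \<open>oedge a = oedge b\<close> a(3) b(3) by (simp add: prod_eq_iff)
  moreover have "ohead a = x"
    using disj a(1,4) b(1) \<open>a = b\<close> by (auto simp: disjnt_def trail_verts_def)
  moreover have "p' = []" if "ohead a = x" "rpath {} (a # p') x s" for a p' s
  proof (rule ccontr)
    assume "p' \<noteq> []"
    then have "x \<in> ohead ` set p'"
      using rpath_last[OF that(2)] by (auto simp: trail_verts_def last_map)
    with that show False
      by (auto simp: rpath_def bipath_def trail_verts_def)
  qed
  ultimately show ?thesis
    using a(1) b(1) p q by blast
qed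

text \<open>Families on either side yield families of the same size on the other, so both maxima are
  taken over the same set of numbers.\<close>

lemma kappa_skeleton:
  assumes x: "x \<in> bverts B" "special x" "x \<noteq> r"
  shows "bi_kappa B r x = di_kappa (skeleton B r) r x"
proof -
  let ?D = "skeleton B r" and ?\<pi> = "skeleton_proj B r"
  let ?W = "\<lambda>p. set (trail_verts r p) - {r, x}"
  let ?V = "\<lambda>p. set (pre_digraph.awalk_verts ?D r p) - {r, x}"
  let ?fam = "\<lambda>path V P. finite P \<and> (\<forall>p \<in> P. path r p x) \<and> pairwise (\<lambda>p q. disjnt (V p) (V q)) P"
  have \<pi>x: "?\<pi> x = x"
    using x skeleton_proj_id by blast
  have "\<exists>Q. card P = card Q \<and> ?fam (pre_digraph.apath ?D) ?V Q" if P: "?fam (bipath B) ?W P" for P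
  proof (intro exI conjI)
    have rp: "\<exists>s. rpath {} p x s" if "p \<in> P" for p
      using P that bipath_rpath by blast
    have sub: "?V (proj_path p) \<subseteq> ?W p" if "p \<in> P" for p
      using rp[OF that] rpath_proj by blast
    have "inj_on proj_path P"
    proof (rule inj_onI)
      fix p q assume pq: "p \<in> P" "q \<in> P" "proj_path p = proj_path q"
      show "p = q"
      proof (rule ccontr)
        assume "p \<noteq> q"
        then have "disjnt (?W p) (?W q)"
          using P pq by (auto simp: pairwise_def)
        then show False
          using rp[OF pq(1)] rp[OF pq(2)] rpath_inj_proj x(3) pq(3) \<open>p \<noteq> q\<close> by blast
      qed
    qed
    then show "card P = card (proj_path ` P)"
      by (simp add: card_image)
    show "finite (proj_path ` P)"
      using P by simp
    show "\<forall>q \<in> proj_path ` P. pre_digraph.apath ?D r q x"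
      using rp rpath_proj \<pi>x by fastforce
    show "pairwise (\<lambda>p q. disjnt (?V p) (?V q)) (proj_path ` P)"
    proof (rule pairwiseI)
      fix p' q' assume "p' \<in> proj_path ` P" "q' \<in> proj_path ` P" "p' \<noteq> q'"
      then obtain p q where pq: "p' = proj_path p" "q' = proj_path q" "p \<in> P" "q \<in> P" "p \<noteq> q"
        by blast
      then have "disjnt (?W p) (?W q)"
        using P by (simp add: pairwise_def)
      then show "disjnt (?V p') (?V q')"
        using sub[OF pq(3)] sub[OF pq(4)] unfolding pq(1,2) by (meson disjnt_subset1 disjnt_subset2)
    qed
  qed
  moreover have "\<exists>P. card Q = card P \<and> ?fam (bipath B) ?W P"
    if Q: "?fam (pre_digraph.apath ?D) ?V Q" for Q
  proof -
    have "\<forall>p \<in> Q. \<exists>q s. rpath {} q x s \<and> proj_path q = p \<and>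
        ?\<pi> ` set (trail_verts r q) \<subseteq> set (pre_digraph.awalk_verts ?D r p) \<and>
        (\<forall>v \<in> set (trail_verts r q). ?\<pi> v = x \<longrightarrow> v = x)"
      using Q apath_lift by blast
    then obtain lift where lift: "\<And>p. p \<in> Q \<Longrightarrow> \<exists>s. rpath {} (lift p) x s"
      "\<And>p. p \<in> Q \<Longrightarrow> proj_path (lift p) = p"
      "\<And>p. p \<in> Q \<Longrightarrow> ?\<pi> ` set (trail_verts r (lift p)) \<subseteq> set (pre_digraph.awalk_verts ?D r p)"
      "\<And>p v. p \<in> Q \<Longrightarrow> v \<in> set (trail_verts r (lift p)) \<Longrightarrow> ?\<pi> v = x \<Longrightarrow> v = x"
      by metis
    have "inj_on lift Q"
      using lift(2) by (rule inj_on_inverseI)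
    \<comment> \<open>Only \<open>r\<close> projects to \<open>r\<close>, and on the lift only
      \<open>x\<close> projects to \<open>x\<close>. So a common internal vertex of two lifts would
      give one of the directed paths.\<close>
    have W: "?\<pi> v \<in> ?V p" if p: "p \<in> Q" and v: "v \<in> ?W (lift p)" for p v
    proof -
      obtain s where s: "rpath {} (lift p) x s"
        using lift(1)[OF p] by blast
      obtain q q' t where "lift p = q @ q'" "rpath {} q v t"
        using rpath_through[OF s, of v] v by blast
      then have "v \<in> bverts B"
        using reach_in_verts unfolding reach_def by blast
      then show ?thesis
        using lift(3)[OF p] lift(4)[OF p, of v] v skeleton_proj_root_iff by blast
    qed
    have "pairwise (\<lambda>p q. disjnt (?W p) (?W q)) (lift ` Q)"
    proof (rule pairwiseI)
      fix p' q' assume "p' \<in> lift ` Q" "q' \<in> lift ` Q" "p' \<noteq> q'"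
      then obtain p q where pq: "p' = lift p" "q' = lift q" "p \<in> Q" "q \<in> Q" "p \<noteq> q"
        by blast
      then have "disjnt (?V p) (?V q)"
        using Q by (auto simp: pairwise_def)
      then show "disjnt (?W p') (?W q')"
        using W[OF pq(3)] W[OF pq(4)] unfolding pq disjnt_iff by blast
    qed
    moreover have "\<forall>p \<in> lift ` Q. bipath B r p x"
      using lift(1) rpath_bipath by blast
    ultimately show ?thesis
      using Q \<open>inj_on lift Q\<close> by (intro exI[of _ "lift ` Q"]) (simp add: card_image)
  qed
  ultimately have "{card P | P. ?fam (bipath B) ?W P} = {card Q | Q. ?fam (pre_digraph.apath ?D) ?V Q}"
    by blast
  then show ?thesis
    by (simp add: bi_kappa_def di_kappa_def)
qed

text \<open>Every path to \<open>x\<close> has the projection of \<open>x\<close> as an internal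
  vertex, so no two are disjoint; and there is a path, since a nonspecial vertex other than the root
  is reachable.\<close>

lemma kappa_nonspecial:
  assumes x: "x \<in> bverts B" "\<not> special x"
  shows "bi_kappa B r x = 1"
proof -
  let ?W = "\<lambda>p. set (trail_verts r p) - {r, x}"
  let ?fam = "\<lambda>P. finite P \<and> (\<forall>p \<in> P. bipath B r p x) \<and> pairwise (\<lambda>p q. disjnt (?W p) (?W q)) P"
  have proj: "skeleton_proj B r x \<noteq> x" "skeleton_proj B r x \<noteq> r"
    using skeleton_proj_special[OF x(1)] skeleton_proj_root_iff[OF x(1)] x(2)
    by (auto simp: special_def)
  have mem: "skeleton_proj B r x \<in> ?W p" if p: "bipath B r p x" for p
  proof -
    obtain s where "rpath {} p x s"
      using bipath_rpath p by blast
    from rpath_split[OF this] obtain p1 p2 t where "p = p1 @ p2" "rpath {} p1 (skeleton_proj B r x) t"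
      by blast
    then show ?thesis
      using rpath_end_in proj by auto
  qed
  have le1: "card P \<le> 1" if P: "?fam P" for P
  proof -
    have "p = q" if pq: "p \<in> P" "q \<in> P" for p q
    proof (rule ccontr)
      assume "p \<noteq> q"
      then have "disjnt (?W p) (?W q)"
        using P pq by (simp add: pairwise_def)
      moreover have "skeleton_proj B r x \<in> ?W p \<inter> ?W q"
        using mem P pq by blast
      ultimately show False
        unfolding disjnt_def by blast
    qed
    then show ?thesis
      using P by (simp add: card_le_Suc0_iff_eq)
  qed
  obtain p where "bipath B r p x"
    using x(2) by (auto simp: special_def plain_def reach_def rpath_def)
  then have "?fam {p}"
    by simp
  then have "1 \<in> {card P | P. ?fam P}"
    by (intro CollectI exI[of _ "{p}"]) simp
  moreover have "{card P | P. ?fam P} \<subseteq> {..1}"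
    using le1 by auto
  ultimately show ?thesis
    unfolding bi_kappa_def by (intro Max_eqI) (auto intro: finite_subset)
qed

end

theorem theorem8p6:
  fixes B :: "('v, 'e) bigraph" and r :: 'v
  assumes "finite_rooted_bidirected_graph B r"
    and "clean B r"
    and "path_reachable B r"
  shows "(\<forall>x \<in> verts (skeleton B r) - {r}. bi_kappa B r x = di_kappa (skeleton B r) r x) \<and>
         (\<forall>x \<in> bverts B - verts (skeleton B r). bi_kappa B r x = 1)"
proof -
  interpret clean_bidirected_graph B r
    using assms(1,2) by (simp add: clean_bidirected_graph_def clean_bidirected_graph_axioms_def)
  show ?thesis
    using kappa_skeleton kappa_nonspecial by (auto simp: verts_skeleton)
qed

end
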